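(* Let $|q|<1$, fix a square root $q^{1/2}$ of $q$, and set $q^{m/2}=(q^{1/2})^m$ for integers $m\ge 0$. Let $$B_1(q)=\frac{f(-q^6, -q^{20})}{f(-q^7, -q^{19})},\quad B_2(q)=\frac{f(-q^5, -q^{21})}{f(-q^8, -q^{18})},\quad B_3(q)=\frac{f(-q^4, -q^{22})}{f(-q^9, -q^{17})},$$ $$B_4(q)=\frac{f(-q^3, -q^{23})}{f(-q^{10}, -q^{16})},\quad B_5(q)=\frac{f(-q^2, -q^{24})}{f(-q^{11}, -q^{15})},\quad B_6(q)=\frac{f(-q, -q^{25})}{f(-q^{12}, -q^{14})}.$$ Then the following hold, where in each of (i)--(vi) either all upper signs or all lower signs are taken: (i) $\dfrac{1}{B_1(q)} \mp q^{1/2}B_1(q)= \dfrac{f(\mp q^{1/2}, \mp q^{25/2})\, \varphi(\pm q^{13/2})}{f(-q^6, -q^7)\, \psi(q^{13})}$; (ii) $\dfrac{1}{B_2(q)} \mp q^{3/2}B_2(q)= \dfrac{f(\mp q^{3/2}, \mp q^{23/2})\, \varphi(\pm q^{13/2})}{f(-q^5, -q^8)\, \psi(q^{13})}$; (iii) $\dfrac{1}{B_3(q)} \mp q^{5/2}B_3(q)= \dfrac{f(\mp q^{5/2}, \mp q^{21/2})\, \varphi(\pm q^{13/2})}{f(-q^4, -q^9)\, \psi(q^{13})}$; (iv) $\dfrac{1}{B_4(q)} \mp q^{7/2}B_4(q)= \dfrac{f(\mp q^{7/2}, \mp q^{19/2})\, \varphi(\pm q^{13/2})}{f(-q^3, -q^{10})\,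 \psi(q^{13})}$; (v) $\dfrac{1}{B_5(q)} \mp q^{9/2}B_5(q)= \dfrac{f(\mp q^{9/2}, \mp q^{17/2})\, \varphi(\pm q^{13/2})}{f(-q^2, -q^{11})\, \psi(q^{13})}$; (vi) $\dfrac{1}{B_6(q)} \mp q^{11/2}B_6(q)= \dfrac{f(\mp q^{11/2}, \mp q^{15/2})\, \varphi(\pm q^{13/2})}{f(-q, -q^{12})\, \psi(q^{13})}$; (vii) $\displaystyle \prod_{i=1}^{6}\left(\frac{1}{B_i(q)}+q^{(2(i-1)+1)/2}B_i(q)\right)=\frac{\varphi^6(-q^{13/2})}{\psi^6(q^{13})\,f(-q)}\prod_{i=1}^{6}\left(-q^{\pm(2(i-1)+1)/2};\,q^{13}\right)_\infty ,$ where $(-q^{\pm r};q^{13})_\infty$ denotes $(-q^{r};q^{13})_\infty(-q^{13-r};q^{13})_\infty$.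
   Context: Ramanujan's general theta function is $f(a,b)=\sum_{n=-\infty}^{\infty} a^{n(n+1)/2}b^{n(n-1)/2}$ for $|ab|<1$. Also $\varphi(q)=f(q,q)=\sum_{n=-\infty}^\infty q^{n^2}$, $\psi(q)=f(q,q^3)=\sum_{n=0}^{\infty} q^{n(n+1)/2}$, and, with one argument, $f(-q)=f(-q,-q^2)=(q;q)_\infty$, for $|q|<1$. Here $(\lambda;q)_\infty=\prod_{j=0}^{\infty}(1-\lambda q^j)$.
   Formalization: In (vii) the right-hand side carries an additional numerator factor f(-q^13); the formula as printed fails for every real 0<q<1 with q^{1/2}>0, because multiplying the lower-sign cases of (i)–(vi) leaves one uncancelled factor (q^13;q^13)_∞ = f(-q^13). *)

theory Defs
  imports "HOL-Analysis.Analysis"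
begin

text \<open>
  The exponents are natural numbers, because \<open>n * (n + 1)\<close> and \<open>n * (n - 1)\<close> are even and
  nonnegative for every integer \<open>n\<close>; so the definition also makes sense when \<open>a\<close> or \<open>b\<close>
  is \<open>0\<close>, with \<open>0 ^ 0 = 1\<close>. The series converges absolutely if \<open>norm (a * b) < 1\<close>.
\<close>

definition theta_f :: "complex \<Rightarrow> complex \<Rightarrow> complex" where
  "theta_f a b =
     (\<Sum>\<^sub>\<infinity>n::int. a ^ nat (n * (n + 1) div 2) * b ^ nat (n * (n - 1) div 2))"

definition theta_phi :: "complex \<Rightarrow> complex" where
  "theta_phi q = theta_f q q"

definition theta_psi :: "complex \<Rightarrow> complex" where
  "theta_psi q = theta_f q (q ^ 3)"

text \<open>
  Ramanujan's one-argument function is given by \<open>f(-q) = f(-q, -q^2)\<close>; with \<open>x = -q\<close> this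
  reads \<open>f(x) = f(x, -x^2)\<close>.
\<close>

definition theta_f1 :: "complex \<Rightarrow> complex" where
  "theta_f1 x = theta_f x (- (x ^ 2))"

definition qpoch_inf :: "complex \<Rightarrow> complex \<Rightarrow> complex" where
  "qpoch_inf l q = (\<Prod>j. 1 - l * q ^ j)"

text \<open>Only the indices \<open>i = 1, \<dots>, 6\<close> are meant, so no subtraction is truncated.\<close>

definition theta_B :: "nat \<Rightarrow> complex \<Rightarrow> complex" where
  "theta_B i q =
     theta_f (- (q ^ (7 - i))) (- (q ^ (19 + i))) / theta_f (- (q ^ (6 + i))) (- (q ^ (20 - i)))"

text \<open>
  Warning: the source of the product formula for
  \<open>1 / theta_B i q + s ^ (2 * (i - 1) + 1) * theta_B i q\<close>, where \<open>s ^ 2 = q\<close>, omits the factor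
  \<open>f(-q^13)\<close> from the numerator. Without it the formula fails: multiplying the six single
  identities and using the Jacobi triple product yields exactly this factor, and
  \<open>f(-q^13) = (q^13; q^13)\<close> is not \<open>1\<close> in general. The statement here includes it, as
  \<open>theta_f1 (- (q ^ 13))\<close>.
\<close>

end

theory Submission
  imports Defs
begin

text \<open>
  All six single identities are one identity in two parameters. Put \<open>x = e s\<^sup>2\<^sup>i\<^sup>-\<^sup>1\<close> and
  \<open>P = e s\<^sup>1\<^sup>3\<close> with \<open>e = 1\<close> or \<open>e = -1\<close>, so that \<open>P\<^sup>2 = q\<^sup>1\<^sup>3\<close>, and let
  \<open>A = f(-P x, -P\<^sup>3/x)\<close> and \<open>C = f(-P/x, -P\<^sup>3 x)\<close>. Then \<open>B\<^sub>i(q) = C/A\<close>, whence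
  \<open>1/B\<^sub>i - x B\<^sub>i = (A\<^sup>2 - x C\<^sup>2) / (A C)\<close> (both sides are \<open>0\<close> if \<open>A C = 0\<close>), and the claim splits into two product formulas,
  \<open>A\<^sup>2 - x C\<^sup>2 = f(-x, -P\<^sup>2/x) \<phi>(P)\<close> and \<open>A C = f(-P/x, -P x) \<psi>(P\<^sup>2)\<close>.

  Both come from the classical formula for \<open>f(a,b) f(c,d)\<close> with \<open>a b = c d\<close>
  (\<open>theta_f_mult_theta_f\<close>), which splits the double series according to the parity of the sum of
  the two indices. For the first formula \<open>c = d = P\<close>. For the second \<open>c = 1\<close> and \<open>d = P\<^sup>2\<close>: both
  halves of the double series are then equal to \<open>A C\<close>, and \<open>f(1, P\<^sup>2) = 2 \<psi>(P\<^sup>2)\<close>. Parameters have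
  to be nonzero here; for \<open>q = 0\<close> every theta function in the claim is \<open>1\<close>.

  For the product over \<open>i\<close>, multiply the six identities with \<open>e = -1\<close> and expand the theta
  functions by the Jacobi triple product (\<open>jacobi_triple_product\<close>). In the denominators the
  factors \<open>(q\<^sup>k; q\<^sup>1\<^sup>3)\<close> with \<open>k = 1, \<dots>, 12\<close> appear, each once, and together with
  \<open>(q\<^sup>1\<^sup>3; q\<^sup>1\<^sup>3)\<close> they make up \<open>(q; q)\<close>. Six factors \<open>(q\<^sup>1\<^sup>3; q\<^sup>1\<^sup>3)\<close> in the numerator stand
  against five left in the denominator, so one survives.
\<close>

section \<open>The theta series\<close>

definition theta_term :: "complex \<Rightarrow> complex \<Rightarrow> int \<Rightarrow> complex" where
  "theta_term a b n = a ^ nat (n * (n + 1) div 2) * b ^ nat (n * (n - 1) div 2)"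

lemma theta_f_eq_infsum: "theta_f a b = (\<Sum>\<^sub>\<infinity>n. theta_term a b n)"
  by (simp add: theta_f_def theta_term_def)

lemma theta_term_minus: "theta_term a b (- n) = theta_term b a n"
  by (simp add: theta_term_def algebra_simps)

lemma theta_term_0 [simp]: "theta_term a b 0 = 1"
  by (simp add: theta_term_def)

text \<open>
  The ratio of consecutive terms tends to \<open>0\<close> if \<open>\<bar>a b\<bar> < 1\<close>, which gives summability on each half of the
  integers; the negative half is the positive half with \<open>a\<close> and \<open>b\<close> exchanged.
\<close>

lemma theta_term_plus_1:
  assumes "n \<ge> 0"
  shows "theta_term a b (n + 1) = a * (a * b) ^ nat n * theta_term a b n"
proof -
  have "(n + 1) * (n + 1 + 1) = n * (n + 1) + (n + 1) * 2" "(n + 1) * (n + 1 - 1) = n * (n - 1) + n * 2"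
    by (simp_all add: algebra_simps)
  hence 1: "(n + 1) * (n + 1 + 1) div 2 = n * (n + 1) div 2 + (n + 1)"
    and 2: "(n + 1) * (n + 1 - 1) div 2 = n * (n - 1) div 2 + n"
    by simp_all
  have nn: "n * (n + 1) div 2 \<ge> 0" "n * (n - 1) div 2 \<ge> 0"
    using assms by (cases "n = 0"; simp add: pos_imp_zdiv_nonneg_iff)+
  show ?thesis
    unfolding theta_term_def 1 2
    using assms nn by (simp add: nat_add_distrib power_add power_mult_distrib)
qed

lemma summable_theta_term_nat:
  assumes "norm (a * b) < 1"
  shows "summable (\<lambda>n. norm (theta_term a b (int n)))"
proof -
  have "(\<lambda>n. norm a * norm (a * b) ^ n) \<longlonglongrightarrow> norm a * 0"
    using assms by (intro tendsto_intros LIMSEQ_realpow_zero) auto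
  hence "eventually (\<lambda>n. norm a * norm (a * b) ^ n < 1/2) sequentially"
    by (intro order_tendstoD) auto
  then obtain N where N: "\<And>n. n \<ge> N \<Longrightarrow> norm a * norm (a * b) ^ n < 1/2"
    by (auto simp: eventually_sequentially)
  show ?thesis
  proof (rule summable_ratio_test)
    fix n assume "n \<ge> N"
    have "norm (theta_term a b (int (Suc n))) = norm a * norm (a * b) ^ n * norm (theta_term a b (int n))"
      using theta_term_plus_1[of "int n" a b] by (simp add: norm_mult norm_power add.commute)
    also have "\<dots> \<le> 1/2 * norm (theta_term a b (int n))"
      using N[OF \<open>n \<ge> N\<close>] by (intro mult_right_mono) auto
    finally show "norm (norm (theta_term a b (int (Suc n)))) \<le> 1/2 * norm (norm (theta_term a b (int n)))"
      by simp
  qed simp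
qed

lemma abs_summable_theta_term:
  assumes "norm (a * b) < 1"
  shows "(\<lambda>n. norm (theta_term a b n)) summable_on UNIV"
proof -
  let ?f = "\<lambda>n. norm (theta_term a b n)"
  have "?f summable_on range int"
    using summable_theta_term_nat[OF assms]
    by (subst summable_on_reindex) (auto simp: o_def intro!: norm_summable_imp_summable_on)
  moreover have "summable (\<lambda>n. norm (theta_term b a (int (Suc n))))"
    using summable_theta_term_nat[of b a] assms by (subst summable_Suc_iff) (simp add: mult.commute)
  hence "?f summable_on range (\<lambda>n. - int (Suc n))"
    unfolding o_def
    by (subst summable_on_reindex)
       (auto simp: o_def inj_on_def theta_term_minus simp del: of_nat_Suc intro!: norm_summable_imp_summable_on)
  ultimately have "?f summable_on (range int \<union> range (\<lambda>n. - int (Suc n)))"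
    by (rule summable_on_Un_disjoint) auto
  also have "range int \<union> range (\<lambda>n. - int (Suc n)) = UNIV"
  proof (rule UNIV_eq_I[symmetric])
    show "x \<in> range int \<union> range (\<lambda>n. - int (Suc n))" for x
      by (cases x rule: int_cases) auto
  qed
  finally show ?thesis .
qed

lemma has_sum_theta_f:
  assumes "norm (a * b) < 1"
  shows "(theta_term a b has_sum theta_f a b) UNIV"
  unfolding theta_f_eq_infsum
  using abs_summable_summable[OF abs_summable_theta_term[OF assms]] by (rule has_sum_infsum)

lemma theta_f_commute: "theta_f a b = theta_f b a"
proof -
  have "theta_f a b = (\<Sum>\<^sub>\<infinity>n. theta_term a b (- n))"
    unfolding theta_f_eq_infsum
    by (rule infsum_reindex_bij_witness[of _ uminus uminus]) auto
  thus ?thesis by (simp add: theta_term_minus theta_f_eq_infsum)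
qed

lemma theta_f_0_0 [simp]: "theta_f 0 0 = 1"
proof -
  have "theta_term 0 0 j = (if j = 0 then 1 else 0)" for j
  proof -
    have "nat (j * (j + 1) div 2) \<noteq> 0 \<or> nat (j * (j - 1) div 2) \<noteq> 0" if "j \<noteq> 0"
    proof -
      have "j \<ge> 1 \<or> j \<le> -1" using that by linarith
      hence "j * (j + 1) \<ge> 2 \<or> j * (j - 1) \<ge> 2"
        using mult_mono[of 1 j 2 "j + 1"] mult_mono[of 1 "- j" 2 "1 - j"]
        by (auto simp: algebra_simps)
      thus ?thesis by auto
    qed
    thus ?thesis by (cases "j = 0") (auto simp: theta_term_def zero_power)
  qed
  hence "theta_f 0 0 = (\<Sum>\<^sub>\<infinity>j\<in>{0}. theta_term 0 0 j)"
    unfolding theta_f_eq_infsum by (intro infsum_cong_neutral) auto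
  thus ?thesis by simp
qed

text \<open>
  With exponential parameters a term is the exponential of a polynomial in the index. An identity
  between products of terms thereby reduces to a polynomial identity over the complex numbers, without
  integer division or case distinctions on signs of exponents.
\<close>

lemma theta_term_exp:
  "theta_term (exp x) (exp y) n =
     exp (of_int n * (of_int n + 1) / 2 * x + of_int n * (of_int n - 1) / 2 * y)"
proof -
  have nonneg: "n * (n + 1) \<ge> 0" "n * (n - 1) \<ge> 0"
    by (auto simp: zero_le_mult_iff)
  have e: "of_nat (nat (k div 2)) = (of_int k / 2 :: complex)" if "even k" "k \<ge> 0" for k :: int
  proof -
    from that obtain m where "k = 2 * m" "m \<ge> 0" by (auto elim: evenE)
    thus ?thesis by (simp add: of_nat_nat)
  qed
  show ?thesis
    unfolding theta_term_def
    by (subst (1 2) exp_of_nat_mult[symmetric], subst (1 2) e) (auto simp: nonneg exp_add)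
qed

section \<open>Products of two theta functions\<close>

lemma has_sum_product:
  fixes f :: "'a \<Rightarrow> complex" and g :: "'b \<Rightarrow> complex"
  assumes "(\<lambda>x. norm (f x)) summable_on A" "(\<lambda>y. norm (g y)) summable_on B"
  shows "((\<lambda>(x, y). f x * g y) has_sum (infsum f A * infsum g B)) (A \<times> B)"
proof -
  have "(\<lambda>p. norm ((\<lambda>(x, y). f x * g y) p)) summable_on (A \<times> B)"
  proof (rule Infinite_Sum.abs_summable_on_Sigma_iff[THEN iffD2], intro conjI ballI)
    show "(\<lambda>y. norm (case (x, y) of (x, y) \<Rightarrow> f x * g y)) summable_on B" for x
      using summable_on_cmult_right[OF assms(2), of "norm (f x)"] by (simp add: norm_mult)
    have "(\<lambda>x. norm (f x) * infsum (\<lambda>y. norm (g y)) B) summable_on A"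
      by (rule summable_on_cmult_left[OF assms(1)])
    thus "(\<lambda>x. norm (infsum (\<lambda>y. norm (case (x, y) of (x, y) \<Rightarrow> f x * g y)) B)) summable_on A"
      by (simp add: norm_mult infsum_cmult_right' abs_mult infsum_nonneg)
  qed
  hence *: "(\<lambda>(x, y). f x * g y) summable_on (A \<times> B)"
    by (rule abs_summable_summable)
  have "infsum (\<lambda>(x, y). f x * g y) (A \<times> B) = (\<Sum>\<^sub>\<infinity>x\<in>A. \<Sum>\<^sub>\<infinity>y\<in>B. f x * g y)"
    using infsum_Sigma'_banach[OF *] by simp
  also have "\<dots> = infsum f A * infsum g B"
    by (simp add: infsum_cmult_right' infsum_cmult_left')
  finally show ?thesis using has_sum_infsum[OF *] by simp
qed

text \<open>
  Pairs \<open>(m, n)\<close> with \<open>m + n\<close> even are \<open>(i + j, i - j)\<close>, those with \<open>m + n\<close> odd are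
  \<open>(1 - i - j, j - i)\<close>. Because \<open>a b = c d\<close>, the mixed terms \<open>i j\<close> in the exponents cancel under
  both substitutions, so each half of the double series is again a product of two theta series.
\<close>

theorem theta_f_mult_theta_f:
  assumes ab: "norm (a * b) < 1" and cd: "a * b = c * d"
    and nz: "a \<noteq> 0" "b \<noteq> 0" "c \<noteq> 0"
  shows "theta_f a b * theta_f c d =
           theta_f (a * c) (b * d) * theta_f (a * d) (b * c) +
           a * (theta_f (b / c) (a * c\<^sup>2 * d) * theta_f (b / d) (a * c * d\<^sup>2))"
proof -
  from nz cd have [simp]: "d \<noteq> 0" by auto
  define \<alpha> \<beta> \<gamma> \<delta> where "\<alpha> = Ln a" "\<beta> = Ln b" "\<gamma> = Ln c" "\<delta> = \<alpha> + \<beta> - \<gamma>"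
  note defs = this
  have a: "a = exp \<alpha>" and b: "b = exp \<beta>" and c: "c = exp \<gamma>"
    using nz by (simp_all add: defs)
  have d: "d = exp \<delta>"
    using cd by (simp add: defs(4) exp_add exp_diff a b c)
  have exps: "a * c = exp (\<alpha> + \<gamma>)" "b * d = exp (\<beta> + \<delta>)" "a * d = exp (\<alpha> + \<delta>)"
    "b * c = exp (\<beta> + \<gamma>)" "b / c = exp (\<beta> - \<gamma>)" "a * c\<^sup>2 * d = exp (\<alpha> + 2 * \<gamma> + \<delta>)"
    "b / d = exp (\<beta> - \<delta>)" "a * c * d\<^sup>2 = exp (\<alpha> + \<gamma> + 2 * \<delta>)"
    by (simp_all add: a b c d exp_add exp_diff exp_double power2_eq_square)
  let ?F = "\<lambda>(m, n). theta_term a b m * theta_term c d n"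
  let ?h = "\<lambda>(i, j). (i + j, i - j) :: int \<times> int"
  let ?k = "\<lambda>(i, j). (1 - i - j, j - i) :: int \<times> int"
  have lt: "norm ((a * c) * (b * d)) < 1" "norm ((a * d) * (b * c)) < 1"
    "norm ((b / c) * (a * c\<^sup>2 * d)) < 1" "norm ((b / d) * (a * c * d\<^sup>2)) < 1"
  proof -
    have "norm (a * b) * norm (a * b) < 1 * 1"
      by (rule mult_strict_mono') (use ab in auto)
    hence *: "norm ((a * b) * (c * d)) < 1" using cd by (simp add: norm_mult)
    have "(a * c) * (b * d) = a * b * (c * d)" "(a * d) * (b * c) = a * b * (c * d)"
      "(b / c) * (a * c\<^sup>2 * d) = a * b * (c * d)" "(b / d) * (a * c * d\<^sup>2) = a * b * (c * d)"
      by (simp_all add: power2_eq_square)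
    note eq = this
    show "norm ((a * c) * (b * d)) < 1" "norm ((a * d) * (b * c)) < 1"
    "norm ((b / c) * (a * c\<^sup>2 * d)) < 1" "norm ((b / d) * (a * c * d\<^sup>2)) < 1" 
      unfolding eq by (fact *)+
  qed
  have prod: "((\<lambda>(x, y). theta_term a' b' x * theta_term c' d' y) has_sum theta_f a' b' * theta_f c' d') UNIV"
    if "norm (a' * b') < 1" "norm (c' * d') < 1" for a' b' c' d'
    using has_sum_product[OF that[THEN abs_summable_theta_term]] by (simp add: theta_f_eq_infsum)
  have even_term: "theta_term a b (i + j) * theta_term c d (i - j) =
      theta_term (a * c) (b * d) i * theta_term (a * d) (b * c) j" for i j
    unfolding exps(1-4) unfolding a b c d theta_term_exp exp_add[symmetric] defs(4)
    by (rule arg_cong[of _ _ exp]) (simp add: field_simps)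
  have odd_term: "theta_term a b (1 - i - j) * theta_term c d (j - i) =
      a * (theta_term (b / c) (a * c\<^sup>2 * d) i * theta_term (b / d) (a * c * d\<^sup>2) j)" for i j
    unfolding exps(5-8) unfolding a b c d theta_term_exp exp_add[symmetric] defs(4)
    by (rule arg_cong[of _ _ exp]) (simp add: field_simps)
  have "(?F has_sum theta_f (a * c) (b * d) * theta_f (a * d) (b * c)) (range ?h)"
    using prod[OF lt(1,2)]
    by (subst has_sum_reindex) (auto simp: inj_on_def o_def case_prod_unfold even_term)
  moreover have "(?F has_sum a * (theta_f (b / c) (a * c\<^sup>2 * d) * theta_f (b / d) (a * c * d\<^sup>2))) (range ?k)"
    using has_sum_cmult_right[OF prod[OF lt(3,4)], of a]
    by (subst has_sum_reindex) (auto simp: inj_on_def o_def case_prod_unfold odd_term)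
  moreover have "range ?h \<inter> range ?k = {}" by (auto simp: image_iff) presburger
  ultimately have "(?F has_sum (theta_f (a * c) (b * d) * theta_f (a * d) (b * c) +
       a * (theta_f (b / c) (a * c\<^sup>2 * d) * theta_f (b / d) (a * c * d\<^sup>2)))) (range ?h \<union> range ?k)"
    by (rule has_sum_Un_disjoint)
  also have "range ?h \<union> range ?k = UNIV"
  proof (rule UNIV_eq_I[symmetric])
    fix p :: "int \<times> int"
    obtain m n where p: "p = (m, n)" by fastforce
    show "p \<in> range ?h \<union> range ?k"
    proof (cases "even (m + n)")
      case True
      hence "p = ?h ((m + n) div 2, (m - n) div 2)" unfolding p by simp presburger
      thus ?thesis by blast
    next
      case False
      hence "p = ?k ((1 - m - n) div 2, (1 - m + n) div 2)" unfolding p by simp presburger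
      thus ?thesis by blast
    qed
  qed
  finally show ?thesis
    using prod[OF ab, of c d] ab cd has_sum_unique by metis
qed

text \<open>
  The substitutions \<open>n = 2 k\<close> and \<open>n = 1 - 2 k\<close> both turn \<open>q\<^bsup>n(n-1)/2\<^esup>\<close> into \<open>q\<^bsup>2k\<^sup>2-k\<^esup>\<close>, the general
  term of \<open>f(q, q\<^sup>3)\<close>.
\<close>

lemma theta_f_1:
  assumes "norm q < 1" "q \<noteq> 0"
  shows "theta_f 1 q = 2 * theta_psi q"
proof -
  define \<alpha> where "\<alpha> = Ln q"
  have q: "q = exp \<alpha>" "q ^ 3 = exp (3 * \<alpha>)"
    using assms exp_of_nat_mult[of 3 \<alpha>] by (simp_all add: \<alpha>_def)
  have term_1: "theta_term 1 q n = exp (of_int n * (of_int n - 1) / 2 * \<alpha>)" for n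
    using theta_term_exp[of 0 \<alpha> n] by (simp add: q(1))
  have term_3: "theta_term q (q ^ 3) n =
      exp (of_int n * (of_int n + 1) / 2 * \<alpha> + of_int n * (of_int n - 1) / 2 * (3 * \<alpha>))" for n
    unfolding q(2) unfolding q(1) by (rule theta_term_exp)
  have "norm (q * q ^ 3) < 1"
    using assms power_less_one_iff[of "norm q" 4] by (simp add: norm_mult norm_power power_numeral_reduce mult_ac)
  hence psi: "(theta_term q (q ^ 3) has_sum theta_psi q) UNIV"
    unfolding theta_psi_def by (rule has_sum_theta_f)
  have even_term: "theta_term 1 q (2 * k) = theta_term q (q ^ 3) k" for k
    unfolding term_1 term_3 by (rule arg_cong[of _ _ exp]) (simp add: field_simps)
  have odd_term: "theta_term 1 q (1 - 2 * k) = theta_term q (q ^ 3) k" for k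
    unfolding term_1 term_3 by (rule arg_cong[of _ _ exp]) (simp add: field_simps)
  have "(theta_term 1 q has_sum theta_psi q) (range (\<lambda>k. 2 * k))"
    using psi by (subst has_sum_reindex) (auto simp: inj_on_def o_def even_term)
  moreover have "(theta_term 1 q has_sum theta_psi q) (range (\<lambda>k. 1 - 2 * k))"
    using psi by (subst has_sum_reindex) (auto simp: inj_on_def o_def odd_term)
  moreover have "range (\<lambda>k::int. 2 * k) \<inter> range (\<lambda>k. 1 - 2 * k) = {}" by auto presburger
  ultimately have "(theta_term 1 q has_sum theta_psi q + theta_psi q) (range (\<lambda>k. 2 * k) \<union> range (\<lambda>k. 1 - 2 * k))"
    by (rule has_sum_Un_disjoint)
  also have "range (\<lambda>k::int. 2 * k) \<union> range (\<lambda>k. 1 - 2 * k) = UNIV"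
  proof (rule UNIV_eq_I[symmetric])
    fix n :: int
    have "n = 2 * (n div 2) \<or> n = 1 - 2 * ((1 - n) div 2)" by presburger
    thus "n \<in> range (\<lambda>k::int. 2 * k) \<union> range (\<lambda>k. 1 - 2 * k)" by blast
  qed
  finally have "(theta_term 1 q has_sum theta_psi q + theta_psi q) UNIV" .
  moreover have "(theta_term 1 q has_sum theta_f 1 q) UNIV"
    using assms by (intro has_sum_theta_f) simp
  ultimately show ?thesis using has_sum_unique by fastforce
qed

text \<open>Identifies the two summands that the product formula yields for \<open>c = 1\<close> and \<open>d = a b\<close>.\<close>

lemma theta_f_shift:
  assumes "norm (a * b) < 1" "a \<noteq> 0" "b \<noteq> 0"
  shows "a * theta_f (1 / a) (a\<^sup>2 * b) = theta_f a b"
proof -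
  define \<alpha> \<beta> where "\<alpha> = Ln a" "\<beta> = Ln b"
  have e: "a = exp \<alpha>" "b = exp \<beta>" using assms by (simp_all add: \<alpha>_\<beta>_def)
  have e': "1 / a = exp (- \<alpha>)" "a\<^sup>2 * b = exp (2 * \<alpha> + \<beta>)"
    by (simp_all add: e exp_add exp_minus exp_double inverse_eq_divide)
  have "a * theta_f (1 / a) (a\<^sup>2 * b) = (\<Sum>\<^sub>\<infinity>k. a * theta_term (1 / a) (a\<^sup>2 * b) k)"
    by (simp add: theta_f_eq_infsum infsum_cmult_right')
  also have "\<dots> = (\<Sum>\<^sub>\<infinity>k. theta_term a b k)"
  proof (rule infsum_reindex_bij_witness[of _ "\<lambda>k. 1 - k" "\<lambda>k. 1 - k"])
    fix k
    show "theta_term a b (1 - k) = a * theta_term (1 / a) (a\<^sup>2 * b) k"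
      unfolding e' unfolding e theta_term_exp exp_add[symmetric]
      by (rule arg_cong[of _ _ exp]) (simp add: field_simps)
  qed auto
  finally show ?thesis by (simp add: theta_f_eq_infsum)
qed

section \<open>The quotient identity\<close>

text \<open>In the product formula with \<open>c = d\<close> both summands become squares up to a factor.\<close>

lemma square_diff_eq_phi:
  assumes P: "norm P < 1" "P \<noteq> 0" and x: "x \<noteq> 0"
  shows "(theta_f (- (P * x)) (- (P ^ 3 / x)))\<^sup>2 - x * (theta_f (- (P / x)) (- (P ^ 3 * x)))\<^sup>2 =
         theta_f (- x) (- (P\<^sup>2 / x)) * theta_phi P"
proof -
  have "norm P ^ 2 < 1" using P by (simp add: power_less_one_iff)
  hence lt: "norm ((- x) * (- (P\<^sup>2 / x))) < 1" using x by (simp add: norm_power)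
  have eq: "(- x) * (- (P\<^sup>2 / x)) = P * P" using x by (simp add: power2_eq_square)
  have args: "- x * P = - (P * x)" "- (P\<^sup>2 / x) * P = - (P ^ 3 / x)"
    "- (P\<^sup>2 / x) / P = - (P / x)" "- x * P\<^sup>2 * P = - (P ^ 3 * x)" "- (P * x) * P\<^sup>2 = - (P ^ 3 * x)"
    using P x by (simp_all add: power2_eq_square power3_eq_cube)
  show ?thesis
    using theta_f_mult_theta_f[OF lt eq] P x unfolding args theta_phi_def
    by (simp add: power2_eq_square)
qed

text \<open>
  In the product formula with \<open>c = 1\<close> and \<open>d = P\<^sup>2\<close> the second summand agrees with the first after
  one application of \<open>theta_f_shift\<close>, so the product of the two functions on the left appears
  twice; the factor \<open>2\<close> cancels against that of \<open>f(1, P\<^sup>2) = 2 \<psi>(P\<^sup>2)\<close>.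
\<close>

lemma product_eq_psi:
  assumes P: "norm P < 1" "P \<noteq> 0" and x: "x \<noteq> 0"
  shows "theta_f (- (P * x)) (- (P ^ 3 / x)) * theta_f (- (P / x)) (- (P ^ 3 * x)) =
         theta_f (- (P / x)) (- (P * x)) * theta_psi (P\<^sup>2)"
proof -
  let ?A = "theta_f (- (P * x)) (- (P ^ 3 / x))" and ?C = "theta_f (- (P / x)) (- (P ^ 3 * x))"
  have P2: "norm P ^ 2 < 1" and P4: "norm P ^ 4 < 1" using P by (simp_all add: power_less_one_iff)
  have lt: "norm ((- (P * x)) * (- (P / x))) < 1"
    using x P2 by (simp add: norm_mult power2_eq_square)
  have eq: "(- (P * x)) * (- (P / x)) = 1 * P\<^sup>2" using x by (simp add: power2_eq_square)
  have args: "- (P * x) * 1 = - (P * x)" "- (P / x) * P\<^sup>2 = - (P ^ 3 / x)"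
    "- (P * x) * P\<^sup>2 = - (P ^ 3 * x)" "- (P / x) * 1 = - (P / x)" "- (P / x) / 1 = - (P / x)"
    "- (P * x) * 1\<^sup>2 * P\<^sup>2 = - (P ^ 3 * x)"
    "- (P / x) / P\<^sup>2 = 1 / (- (P * x))"
    "- (P * x) * (P\<^sup>2)\<^sup>2 = (- (P * x))\<^sup>2 * (- (P ^ 3 / x))"
    using P x by (simp_all add: power2_eq_square power3_eq_cube)
  have "norm ((- (P * x)) * (- (P ^ 3 / x))) < 1"
    using x P4 by (simp add: norm_mult norm_power eval_nat_numeral)
  hence shift: "- (P * x) * theta_f (1 / (- (P * x))) ((- (P * x))\<^sup>2 * (- (P ^ 3 / x))) = ?A"
    using P x by (intro theta_f_shift) auto
  have "theta_f (- (P * x)) (- (P / x)) * theta_f 1 (P\<^sup>2) =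
      ?A * theta_f (- (P ^ 3 * x)) (- (P / x)) +
      - (P * x) * (?C * theta_f (1 / (- (P * x))) ((- (P * x))\<^sup>2 * (- (P ^ 3 / x))))"
    using theta_f_mult_theta_f[OF lt eq] P x unfolding args by simp
  also have "\<dots> = ?A * ?C + ?C * (- (P * x) * theta_f (1 / (- (P * x))) ((- (P * x))\<^sup>2 * (- (P ^ 3 / x))))"
    by (simp add: theta_f_commute[of "- (P ^ 3 * x)"])
  also have "\<dots> = 2 * (?A * ?C)" unfolding shift by simp
  also have "theta_f 1 (P\<^sup>2) = 2 * theta_psi (P\<^sup>2)"
    using P P2 by (intro theta_f_1) (auto simp: norm_power)
  finally show ?thesis by (simp add: theta_f_commute[of "- (P * x)" "- (P / x)"])
qed

text \<open>
  If one of the two theta functions in \<open>B\<close> vanishes, then \<open>B = 0\<close> and \<open>1 / B = 0\<close> by the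
  convention for division by zero. The denominator on the right, being the product of these two
  functions, vanishes as well, so the identity persists.
\<close>

lemma quotient_identity:
  assumes "norm P < 1" "P \<noteq> 0" "x \<noteq> 0"
    and B: "B = theta_f (- (P / x)) (- (P ^ 3 * x)) / theta_f (- (P * x)) (- (P ^ 3 / x))"
  shows "1 / B - x * B =
    theta_f (- x) (- (P\<^sup>2 / x)) * theta_phi P / (theta_f (- (P / x)) (- (P * x)) * theta_psi (P\<^sup>2))"
  unfolding square_diff_eq_phi[OF assms(1-3), symmetric] product_eq_psi[OF assms(1-3), symmetric] B
  by (simp add: divide_simps power2_eq_square)

text \<open>
  The substitution \<open>x = e s\<^sup>2\<^sup>i\<^sup>-\<^sup>1\<close>, \<open>P = e s\<^sup>1\<^sup>3\<close>. The sign cancels in \<open>P x\<close> and \<open>P / x\<close>, which are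
  therefore integral powers of \<open>q = s\<^sup>2\<close>.
\<close>

lemma theta_B_identity:
  assumes s: "norm s < 1" and e: "e \<in> {1, -1}" and i: "i \<in> {1..6}"
  shows "1 / theta_B i (s\<^sup>2) - e * s ^ (2 * i - 1) * theta_B i (s\<^sup>2) =
    theta_f (- e * s ^ (2 * i - 1)) (- e * s ^ (27 - 2 * i)) * theta_phi (e * s ^ 13) /
      (theta_f (- ((s\<^sup>2) ^ (7 - i))) (- ((s\<^sup>2) ^ (6 + i))) * theta_psi ((s\<^sup>2) ^ 13))"
proof (cases "s = 0")
  case True
  thus ?thesis using i by (simp add: theta_B_def theta_phi_def theta_psi_def zero_power)
next
  case False
  let ?x = "e * s ^ (2 * i - 1)" and ?P = "e * s ^ 13"
  have ee: "e * e = 1" "norm e = 1" "e \<noteq> 0" "inverse e = e" "e ^ 3 = e" using e by (auto simp: power3_eq_cube)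
  have pw: "s ^ m / s ^ k = s ^ (m - k)" if "k \<le> m" for m k using False that by (simp add: power_diff)
  have args: "?P * ?x = (s\<^sup>2) ^ (6 + i)" "?P ^ 3 / ?x = (s\<^sup>2) ^ (20 - i)" "?P / ?x = (s\<^sup>2) ^ (7 - i)"
    "?P ^ 3 * ?x = (s\<^sup>2) ^ (19 + i)" "?P\<^sup>2 / ?x = e * s ^ (27 - 2 * i)" "?P\<^sup>2 = (s\<^sup>2) ^ 13"
  proof -
    show "?P * ?x = (s\<^sup>2) ^ (6 + i)"
    proof -
      have "?P * ?x = (e * e) * s ^ (13 + (2 * i - 1))" by (simp only: power_add mult_ac)
      also have "13 + (2 * i - 1) = 2 * (6 + i)" using i by auto
      finally show ?thesis by (simp only: ee power_mult mult_1)
    qed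
    show "?P ^ 3 / ?x = (s\<^sup>2) ^ (20 - i)"
    proof -
      have "?P ^ 3 / ?x = e ^ 3 / e * (s ^ 39 / s ^ (2 * i - 1))"
        by (simp add: power_mult_distrib power_mult[symmetric])
      also have "s ^ 39 / s ^ (2 * i - 1) = s ^ (39 - (2 * i - 1))" using i by (intro pw) auto
      also have "39 - (2 * i - 1) = 2 * (20 - i)" using i by auto
      finally show ?thesis using ee by (simp add: power_mult)
    qed
    show "?P / ?x = (s\<^sup>2) ^ (7 - i)"
    proof -
      have "?P / ?x = s ^ 13 / s ^ (2 * i - 1)" using ee by simp
      also have "\<dots> = s ^ (13 - (2 * i - 1))" using i by (intro pw) auto
      also have "13 - (2 * i - 1) = 2 * (7 - i)" using i by auto
      finally show ?thesis by (simp add: power_mult)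
    qed
    show "?P ^ 3 * ?x = (s\<^sup>2) ^ (19 + i)"
    proof -
      have "?P ^ 3 * ?x = (e ^ 3 * e) * s ^ (39 + (2 * i - 1))"
        by (simp only: power_add mult_ac power_mult_distrib) (simp add: power_mult[symmetric])
      also have "39 + (2 * i - 1) = 2 * (19 + i)" using i by auto
      finally show ?thesis by (simp only: ee power_mult mult_1)
    qed
    show P2: "?P\<^sup>2 = (s\<^sup>2) ^ 13"
      using ee by (simp add: power_mult_distrib power_mult[symmetric] power2_eq_square[of e])
    show "?P\<^sup>2 / ?x = e * s ^ (27 - 2 * i)"
    proof -
      have "?P\<^sup>2 / ?x = inverse e * (s ^ 26 / s ^ (2 * i - 1))"
        unfolding P2 by (simp add: power_mult[symmetric] field_simps)
      also have "s ^ 26 / s ^ (2 * i - 1) = s ^ (26 - (2 * i - 1))" using i by (intro pw) auto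
      also have "26 - (2 * i - 1) = 27 - 2 * i" using i by auto
      finally show ?thesis by (simp only: ee)
    qed
  qed
  have "norm ?P < 1" using s ee by (simp add: norm_mult norm_power power_less_one_iff)
  moreover have "?P \<noteq> 0" "?x \<noteq> 0" using False ee by auto
  moreover have "theta_B i (s\<^sup>2) = theta_f (- (?P / ?x)) (- (?P ^ 3 * ?x)) / theta_f (- (?P * ?x)) (- (?P ^ 3 / ?x))"
    unfolding args by (simp add: theta_B_def)
  ultimately have "1 / theta_B i (s\<^sup>2) - ?x * theta_B i (s\<^sup>2) =
    theta_f (- ?x) (- (?P\<^sup>2 / ?x)) * theta_phi ?P / (theta_f (- (?P / ?x)) (- (?P * ?x)) * theta_psi (?P\<^sup>2))"
    by (rule quotient_identity)
  thus ?thesis unfolding args(1-5) unfolding args(6) by simp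
qed

section \<open>The Jacobi triple product\<close>

text \<open>
  The infinite product is approached through a finite version of the triple product, whose
  coefficients are the central Gaussian binomials
  \<open>(Q;Q)\<^sub>2\<^sub>n / ((Q;Q)\<^sub>n\<^sub>-\<^sub>j (Q;Q)\<^sub>n\<^sub>+\<^sub>j)\<close>.
\<close>

definition qpoch_fin :: "complex \<Rightarrow> nat \<Rightarrow> complex" where
  "qpoch_fin Q n = (\<Prod>k<n. 1 - Q ^ Suc k)"

text \<open>
  The reciprocal of \<open>(Q;Q)\<^sub>m\<close>, set to \<open>0\<close> for negative \<open>m\<close>. With this convention the recurrence
  \<open>qpoch_fin_inv_pred\<close> extends to \<open>m = 0\<close>, and the Gaussian binomials vanish outside
  \<open>\<bar>j\<bar> \<le> n\<close>.
\<close>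

definition qpoch_fin_inv :: "complex \<Rightarrow> int \<Rightarrow> complex" where
  "qpoch_fin_inv Q m = (if m < 0 then 0 else inverse (qpoch_fin Q (nat m)))"

lemma one_minus_power_nonzero:
  assumes "norm (Q :: complex) < 1"
  shows "1 - Q ^ Suc k \<noteq> 0"
proof
  assume "1 - Q ^ Suc k = 0"
  hence "norm (Q ^ Suc k) = 1" by simp
  moreover have "norm (Q ^ Suc k) < 1"
    unfolding norm_power using assms by (subst power_less_one_iff) auto
  ultimately show False by simp
qed

lemma qpoch_fin_nonzero: "norm Q < 1 \<Longrightarrow> qpoch_fin Q n \<noteq> 0"
  using one_minus_power_nonzero by (simp add: qpoch_fin_def)

lemma qpoch_fin_inv_pred:
  assumes "norm Q < 1" "m \<ge> 0"
  shows "qpoch_fin_inv Q (m - 1) = (1 - Q ^ nat m) * qpoch_fin_inv Q m"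
proof (cases "m = 0")
  case False
  with assms obtain k where "m = int (Suc k)"
    by (metis nonneg_int_cases not0_implies_Suc of_nat_0)
  thus ?thesis
    using one_minus_power_nonzero[OF assms(1), of k] qpoch_fin_nonzero[OF assms(1), of k]
    by (simp add: qpoch_fin_inv_def qpoch_fin_def nat_add_distrib field_simps)
qed (auto simp: qpoch_fin_inv_def)

definition central_qbinomial :: "complex \<Rightarrow> nat \<Rightarrow> int \<Rightarrow> complex" where
  "central_qbinomial Q n j =
     qpoch_fin Q (2 * n) * qpoch_fin_inv Q (int n - j) * qpoch_fin_inv Q (int n + j)"

lemma central_qbinomial_eq_0: "\<bar>j\<bar> > int n \<Longrightarrow> central_qbinomial Q n j = 0"
  by (auto simp: central_qbinomial_def qpoch_fin_inv_def)

text \<open>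
  Two steps of the Pascal rule at once. After dividing by a common factor and writing
  \<open>U = Q\<^bsup>n-j\<^esup>\<close> and \<open>V = Q\<^bsup>n+j\<^esup>\<close>, it is a polynomial identity in \<open>Q\<close>, \<open>U\<close> and \<open>V\<close>. The edges
  \<open>j = n + 1\<close> and \<open>j = -n - 1\<close>, where \<open>U\<close> or \<open>V\<close> has a negative exponent, are separate.
\<close>

lemma central_qbinomial_Suc:
  assumes Q: "norm Q < 1"
  shows "central_qbinomial Q (Suc n) j =
           (1 + Q ^ (2 * n + 1)) * central_qbinomial Q n j +
           Q ^ nat (int n + 1 - j) * central_qbinomial Q n (j - 1) +
           Q ^ nat (int n + 1 + j) * central_qbinomial Q n (j + 1)"
proof -
  define u v where "u = int n + 1 - j" and "v = int n + 1 + j"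
  let ?g = "qpoch_fin_inv Q"
  have uv: "u + v = 2 * int n + 2" by (simp add: u_def v_def)
  have args: "int (Suc n) - j = u" "int (Suc n) + j = v" "int n - j = u - 1" "int n + j = v - 1"
    "int n - (j - 1) = u" "int n + (j - 1) = v - 2" "int n - (j + 1) = u - 2" "int n + (j + 1) = v"
    by (simp_all add: u_def v_def)
  have poly: "(1 - Q ^ (2 * n + 1)) * (1 - Q ^ (2 * n + 2)) * (?g u * ?g v) =
      (1 + Q ^ (2 * n + 1)) * (?g (u - 1) * ?g (v - 1)) +
      Q ^ nat u * (?g u * ?g (v - 2)) + Q ^ nat v * (?g (u - 2) * ?g v)"
  proof -
    consider "u < 0" | "v < 0" | "u = 0" | "v = 0" | "u > 0" "v > 0" by linarith
    thus ?thesis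
    proof cases
      case 3
      hence "v = 2 * int n + 2" using uv by simp
      hence "?g (v - 1) = (1 - Q ^ (2 * n + 2)) * ?g v" "?g (v - 1 - 1) = (1 - Q ^ (2 * n + 1)) * ?g (v - 1)"
        using qpoch_fin_inv_pred[OF Q, of v] qpoch_fin_inv_pred[OF Q, of "v - 1"]
        by (simp_all add: nat_add_distrib nat_mult_distrib)
      thus ?thesis using 3 by (simp add: qpoch_fin_inv_def[of Q "- 1"] qpoch_fin_inv_def[of Q "- 2"])
    next
      case 4
      hence "u = 2 * int n + 2" using uv by simp
      hence "?g (u - 1) = (1 - Q ^ (2 * n + 2)) * ?g u" "?g (u - 1 - 1) = (1 - Q ^ (2 * n + 1)) * ?g (u - 1)"
        using qpoch_fin_inv_pred[OF Q, of u] qpoch_fin_inv_pred[OF Q, of "u - 1"]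
        by (simp_all add: nat_add_distrib nat_mult_distrib)
      thus ?thesis using 4 by (simp add: qpoch_fin_inv_def[of Q "- 1"] qpoch_fin_inv_def[of Q "- 2"])
    next
      case 5
      define U V where "U = Q ^ nat (u - 1)" and "V = Q ^ nat (v - 1)"
      have nu: "nat u = Suc (nat (u - 1))" and nv: "nat v = Suc (nat (v - 1))" using 5 by auto
      have U: "Q ^ nat u = Q * U" and V: "Q ^ nat v = Q * V"
        unfolding nu nv by (simp_all add: U_def V_def)
      have "2 * n = nat (u - 1) + nat (v - 1)" using uv 5 by linarith
      hence QQ: "Q ^ (2 * n) = U * V" by (simp add: U_def V_def power_add)
      have g: "?g (u - 1) = (1 - Q * U) * ?g u" "?g (v - 1) = (1 - Q * V) * ?g v"
        "?g (u - 2) = (1 - U) * ?g (u - 1)" "?g (v - 2) = (1 - V) * ?g (v - 1)"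
        using qpoch_fin_inv_pred[OF Q, of u] qpoch_fin_inv_pred[OF Q, of v]
          qpoch_fin_inv_pred[OF Q, of "u - 1"] qpoch_fin_inv_pred[OF Q, of "v - 1"] 5 U V
        by (simp_all add: U_def V_def)
      show ?thesis
        unfolding g U V by (simp add: QQ power_add power2_eq_square) (simp add: algebra_simps)
    qed (auto simp: qpoch_fin_inv_def)
  qed
  have F: "qpoch_fin Q (2 * Suc n) = qpoch_fin Q (2 * n) * ((1 - Q ^ (2 * n + 1)) * (1 - Q ^ (2 * n + 2)))"
    by (simp add: qpoch_fin_def)
  have "central_qbinomial Q (Suc n) j =
      qpoch_fin Q (2 * n) * ((1 - Q ^ (2 * n + 1)) * (1 - Q ^ (2 * n + 2)) * (?g u * ?g v))"
    unfolding central_qbinomial_def F args by (simp only: mult_ac)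
  also have "\<dots> = (1 + Q ^ (2 * n + 1)) * central_qbinomial Q n j +
           Q ^ nat u * central_qbinomial Q n (j - 1) + Q ^ nat v * central_qbinomial Q n (j + 1)"
    unfolding poly central_qbinomial_def args by (simp only: ring_distribs mult_ac)
  finally show ?thesis by (simp add: u_def v_def)
qed

text \<open>
  Turns the factor \<open>a Q\<^sup>n\<close> of the new term in the product into a power of \<open>Q\<close>, as it appears
  in the recurrence of the Gaussian binomials. The bound on \<open>j\<close> keeps the exponent nonnegative.
\<close>

lemma theta_term_shift:
  assumes "j \<le> int n + 1"
  shows "a * (a * b) ^ n * theta_term a b (j - 1) = (a * b) ^ nat (int n + 1 - j) * theta_term a b j"
proof (cases "j \<ge> 1")
  case True
  have "n = nat (int n + 1 - j) + nat (j - 1)" using True assms by linarith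
  hence "(a * b) ^ n = (a * b) ^ nat (int n + 1 - j) * (a * b) ^ nat (j - 1)"
    by (metis power_add)
  thus ?thesis using theta_term_plus_1[of "j - 1" a b] True by simp
next
  case False
  have "nat (int n + 1 - j) = Suc (n + nat (- j))" using False by linarith
  moreover have "theta_term a b (j - 1) = b * (a * b) ^ nat (- j) * theta_term a b j"
    using theta_term_plus_1[of "- j" b a] theta_term_minus[of b a j] theta_term_minus[of b a "j - 1"] False
    by (simp add: mult.commute)
  ultimately show ?thesis by (simp add: power_add)
qed

text \<open>
  Multiplying by \<open>(1 + a Q\<^sup>n)(1 + b Q\<^sup>n) = 1 + Q\<^bsup>2n+1\<^esup> + a Q\<^sup>n + b Q\<^sup>n\<close>, where \<open>Q = a b\<close>, combines
  the coefficients at \<open>j\<close>, \<open>j - 1\<close> and \<open>j + 1\<close> exactly as in \<open>central_qbinomial_Suc\<close>. Summing over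
  all integers makes the shifts of \<open>j\<close> harmless.
\<close>

theorem finite_jacobi_triple_product:
  assumes Q: "norm (a * b) < 1"
  shows "((\<lambda>j. central_qbinomial (a * b) n j * theta_term a b j) has_sum
           (\<Prod>k<n. (1 + a * (a * b) ^ k) * (1 + b * (a * b) ^ k))) UNIV"
proof (induction n)
  case 0
  have "((\<lambda>j. central_qbinomial (a * b) 0 j * theta_term a b j) has_sum 1) {0}"
    using has_sum_finite[of "{0}" "\<lambda>j. central_qbinomial (a * b) 0 j * theta_term a b j"]
    by (simp add: central_qbinomial_def qpoch_fin_inv_def qpoch_fin_def)
  hence "((\<lambda>j. central_qbinomial (a * b) 0 j * theta_term a b j) has_sum 1) UNIV"
    by (rule iffD1[OF has_sum_cong_neutral, rotated -1]) (auto simp: central_qbinomial_eq_0)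
  thus ?case by simp
next
  case (Suc n)
  let ?c = "\<lambda>j. central_qbinomial (a * b) n j" and ?t = "theta_term a b"
  define P where "P = (\<Prod>k<n. (1 + a * (a * b) ^ k) * (1 + b * (a * b) ^ k))"
  note IH = Suc.IH[folded P_def]
  have 1: "((\<lambda>j. ?c (j - 1) * ?t (j - 1)) has_sum P) UNIV"
    using IH by (subst has_sum_reindex_bij_betw[of "\<lambda>j. j - 1" UNIV UNIV]) (auto intro: bij_betwI[of _ _ _ "\<lambda>j. j + 1"])
  have 2: "((\<lambda>j. ?c (j + 1) * ?t (j + 1)) has_sum P) UNIV"
    using IH by (subst has_sum_reindex_bij_betw[of "\<lambda>j. j + 1" UNIV UNIV]) (auto intro: bij_betwI[of _ _ _ "\<lambda>j. j - 1"])
  have "((\<lambda>j. (1 + (a * b) ^ (2 * n + 1)) * (?c j * ?t j) + a * (a * b) ^ n * (?c (j - 1) * ?t (j - 1)) +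
          b * (a * b) ^ n * (?c (j + 1) * ?t (j + 1))) has_sum
        ((1 + (a * b) ^ (2 * n + 1)) * P + a * (a * b) ^ n * P + b * (a * b) ^ n * P)) UNIV"
    by (intro has_sum_add has_sum_cmult_right IH 1 2)
  also have "(1 + (a * b) ^ (2 * n + 1)) * P + a * (a * b) ^ n * P + b * (a * b) ^ n * P =
      (\<Prod>k<Suc n. (1 + a * (a * b) ^ k) * (1 + b * (a * b) ^ k))"
    by (simp only: prod.lessThan_Suc P_def[symmetric]) (simp add: algebra_simps power_add mult_2 mult_2_right)
  also have "(\<lambda>j. (1 + (a * b) ^ (2 * n + 1)) * (?c j * ?t j) + a * (a * b) ^ n * (?c (j - 1) * ?t (j - 1)) +
          b * (a * b) ^ n * (?c (j + 1) * ?t (j + 1))) =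
      (\<lambda>j. central_qbinomial (a * b) (Suc n) j * ?t j)"
  proof
    fix j
    have "a * (a * b) ^ n * (?c (j - 1) * ?t (j - 1)) = (a * b) ^ nat (int n + 1 - j) * ?c (j - 1) * ?t j"
    proof (cases "j \<le> int n + 1")
      case True
      thus ?thesis
        using arg_cong[OF theta_term_shift[OF True, of a b], of "\<lambda>z. z * ?c (j - 1)"]
        by (simp only: mult_ac)
    qed (simp add: central_qbinomial_eq_0)
    moreover have "b * (a * b) ^ n * (?c (j + 1) * ?t (j + 1)) = (a * b) ^ nat (int n + 1 + j) * ?c (j + 1) * ?t j"
    proof (cases "- j \<le> int n + 1")
      case True
      have "b * (a * b) ^ n * ?t (j + 1) = (a * b) ^ nat (int n + 1 + j) * ?t j"
        using theta_term_shift[OF True, of b a] theta_term_minus[of b a j] theta_term_minus[of b a "j + 1"]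
        by (simp add: mult.commute)
      from arg_cong[OF this, of "\<lambda>z. z * ?c (j + 1)"] show ?thesis
        by (simp only: mult_ac)
    qed (simp add: central_qbinomial_eq_0)
    ultimately show "(1 + (a * b) ^ (2 * n + 1)) * (?c j * ?t j) + a * (a * b) ^ n * (?c (j - 1) * ?t (j - 1)) +
          b * (a * b) ^ n * (?c (j + 1) * ?t (j + 1)) = central_qbinomial (a * b) (Suc n) j * ?t j"
      unfolding central_qbinomial_Suc[OF Q] by (simp only: ring_distribs mult_ac)
  qed
  finally show ?case .
qed

lemma convergent_prod_qpoch:
  assumes "norm (Q :: complex) < 1"
  shows "convergent_prod (\<lambda>j. 1 - l * Q ^ j)"
proof -
  have "summable (\<lambda>j. norm l * norm Q ^ j)"
    using assms by (intro summable_mult summable_geometric) auto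
  hence "summable (\<lambda>j. norm ((1 - l * Q ^ j) - 1))"
    by (simp add: norm_mult norm_power)
  thus ?thesis
    by (intro abs_convergent_prod_imp_convergent_prod) (simp add: abs_convergent_prod_conv_summable)
qed

lemma qpoch_inf_LIMSEQ:
  assumes "norm Q < 1"
  shows "(\<lambda>n. \<Prod>j<n. 1 - l * Q ^ j) \<longlonglongrightarrow> qpoch_inf l Q"
  using convergent_prod_LIMSEQ[OF convergent_prod_qpoch[OF assms]]
  by (simp add: qpoch_inf_def LIMSEQ_lessThan_iff_atMost)

lemma qpoch_inf_self_nonzero:
  assumes "norm Q < 1"
  shows "qpoch_inf Q Q \<noteq> 0"
  unfolding qpoch_inf_def using one_minus_power_nonzero[OF assms]
  by (intro prodinf_nonzero convergent_prod_qpoch assms) simp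

text \<open>
  Both \<open>(Q;Q)\<^sub>m\<close> and its reciprocal are bounded in \<open>m\<close>, because the limit is not zero. This
  uniform bound provides the dominating series for the passage to the limit.
\<close>

lemma central_qbinomial_bounded:
  assumes Q: "norm Q < 1"
  obtains M where "\<And>n j. norm (central_qbinomial Q n j) \<le> M"
proof -
  let ?L = "qpoch_inf Q Q"
  have lim: "qpoch_fin Q \<longlonglongrightarrow> ?L"
    using qpoch_inf_LIMSEQ[OF Q, of Q] by (simp add: qpoch_fin_def[abs_def])
  obtain K where K: "\<And>n. norm (qpoch_fin Q n) \<le> K"
    using convergent_imp_Bseq[OF convergentI[OF lim]] by (auto simp: Bseq_def)
  obtain K' where K': "\<And>n. norm (inverse (qpoch_fin Q n)) \<le> K'"
    using convergent_imp_Bseq[OF convergentI[OF tendsto_inverse[OF lim qpoch_inf_self_nonzero[OF Q]]]]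
    by (auto simp: Bseq_def)
  have "K' \<ge> 0" using K'[of 0] norm_ge_zero order_trans by blast
  hence K'': "norm (qpoch_fin_inv Q m) \<le> K'" for m
    using K' by (auto simp: qpoch_fin_inv_def)
  have "norm (central_qbinomial Q n j) \<le> K * K' * K'" for n j
    unfolding central_qbinomial_def norm_mult
    by (intro mult_mono K K'' mult_nonneg_nonneg norm_ge_zero order_trans[OF norm_ge_zero K] \<open>K' \<ge> 0\<close>)
  thus ?thesis by (rule that)
qed

lemma central_qbinomial_LIMSEQ:
  assumes Q: "norm Q < 1"
  shows "(\<lambda>n. central_qbinomial Q n j) \<longlonglongrightarrow> inverse (qpoch_inf Q Q)"
proof -
  let ?L = "qpoch_inf Q Q"
  have lim: "qpoch_fin Q \<longlonglongrightarrow> ?L"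
    using qpoch_inf_LIMSEQ[OF Q, of Q] by (simp add: qpoch_fin_def[abs_def])
  have nz: "?L \<noteq> 0" by (rule qpoch_inf_self_nonzero[OF Q])
  have inv: "(\<lambda>n. qpoch_fin_inv Q (int n + i)) \<longlonglongrightarrow> inverse ?L" for i
  proof -
    have "filterlim (\<lambda>n. nat (int n + i)) at_top sequentially"
      unfolding filterlim_at_top
    proof
      show "eventually (\<lambda>n. nat (int n + i) \<ge> Z) sequentially" for Z
        by (rule eventually_sequentiallyI[of "Z + nat (- i)"]) linarith
    qed
    hence "(\<lambda>n. inverse (qpoch_fin Q (nat (int n + i)))) \<longlonglongrightarrow> inverse ?L"
      using filterlim_compose[OF tendsto_inverse[OF lim nz]] by blast
    moreover have "eventually (\<lambda>n. qpoch_fin_inv Q (int n + i) = inverse (qpoch_fin Q (nat (int n + i)))) sequentially"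
      by (rule eventually_sequentiallyI[of "nat (- i)"]) (auto simp: qpoch_fin_inv_def)
    ultimately show ?thesis by (simp add: tendsto_cong)
  qed
  have "(\<lambda>n. qpoch_fin Q (2 * n)) \<longlonglongrightarrow> ?L"
    using LIMSEQ_subseq_LIMSEQ[OF lim, of "\<lambda>n. 2 * n"] by (simp add: o_def strict_mono_def)
  hence "(\<lambda>n. qpoch_fin Q (2 * n) * qpoch_fin_inv Q (int n + (- j)) * qpoch_fin_inv Q (int n + j)) \<longlonglongrightarrow>
      ?L * inverse ?L * inverse ?L"
    by (intro tendsto_mult inv)
  thus ?thesis using nz by (simp add: central_qbinomial_def)
qed

text \<open>
  Tannery's theorem applied to the finite version, in which the Gaussian binomials tend to
  \<open>1 / (a b; a b)\<^sub>\<infinity>\<close>.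
\<close>

theorem jacobi_triple_product:
  assumes Q: "norm (a * b) < 1"
  shows "theta_f a b = qpoch_inf (- a) (a * b) * qpoch_inf (- b) (a * b) * qpoch_inf (a * b) (a * b)"
proof -
  let ?L = "qpoch_inf (a * b) (a * b)" and ?c = "central_qbinomial (a * b)" and ?t = "theta_term a b"
  obtain M where M: "\<And>n j. norm (?c n j) \<le> M"
    using central_qbinomial_bounded[OF Q] by blast
  \<comment> \<open>Tannery's theorem is about series over the naturals; \<open>int_decode\<close> enumerates the integers.\<close>
  have sums_int: "(\<lambda>k. f (int_decode k)) sums S" if "(f has_sum S) UNIV" for f :: "int \<Rightarrow> 'a :: real_normed_vector" and S
    using that by (intro has_sum_imp_sums) (simp add: has_sum_reindex_bij_betw[OF bij_int_decode])
  have "summable (\<lambda>k. norm (?t (int_decode k)))"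
    using sums_int[OF has_sum_infsum[OF abs_summable_theta_term[OF Q]]] by (rule sums_summable)
  hence "summable (\<lambda>k. M * norm (?t (int_decode k)))" by (rule summable_mult)
  moreover have "eventually (\<lambda>(k, n). norm (?c n (int_decode k) * ?t (int_decode k)) \<le> M * norm (?t (int_decode k)))
      (at_top \<times>\<^sub>F sequentially)"
    by (intro always_eventually) (auto simp: norm_mult intro!: mult_right_mono M)
  ultimately have "(\<lambda>n. \<Sum>k. ?c n (int_decode k) * ?t (int_decode k)) \<longlonglongrightarrow>
      (\<Sum>k. inverse ?L * ?t (int_decode k))"
    by (intro tannerys_theorem[THEN conjunct2, THEN conjunct2] tendsto_intros central_qbinomial_LIMSEQ Q) auto
  moreover have "(\<Sum>k. ?c n (int_decode k) * ?t (int_decode k)) =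
      (\<Prod>k<n. (1 + a * (a * b) ^ k) * (1 + b * (a * b) ^ k))" for n
    using sums_int[OF finite_jacobi_triple_product[OF Q]] by (simp add: sums_iff)
  moreover have "(\<Sum>k. inverse ?L * ?t (int_decode k)) = inverse ?L * theta_f a b"
    using sums_int[OF has_sum_cmult_right[OF has_sum_theta_f[OF Q]]] by (simp add: sums_iff)
  ultimately have "(\<lambda>n. \<Prod>k<n. (1 + a * (a * b) ^ k) * (1 + b * (a * b) ^ k)) \<longlonglongrightarrow> inverse ?L * theta_f a b"
    by simp
  moreover have "(\<lambda>n. \<Prod>k<n. (1 + a * (a * b) ^ k) * (1 + b * (a * b) ^ k)) \<longlonglongrightarrow>
      qpoch_inf (- a) (a * b) * qpoch_inf (- b) (a * b)"
    using tendsto_mult[OF qpoch_inf_LIMSEQ[OF Q, of "- a"] qpoch_inf_LIMSEQ[OF Q, of "- b"]]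
    by (simp add: prod.distrib)
  ultimately have "inverse ?L * theta_f a b = qpoch_inf (- a) (a * b) * qpoch_inf (- b) (a * b)"
    by (rule LIMSEQ_unique)
  thus ?thesis using qpoch_inf_self_nonzero[OF Q] by (simp add: field_simps)
qed

text \<open>The factors \<open>1 - q\<^sup>k\<close> are sorted by the residue of \<open>k\<close> modulo \<open>m\<close>.\<close>

lemma qpoch_inf_dissection:
  assumes q: "norm q < 1" and m: "m > 0"
  shows "qpoch_inf q q = (\<Prod>i=1..m. qpoch_inf (q ^ i) (q ^ m))"
proof -
  have qm: "norm (q ^ m) < 1" using q m by (simp add: norm_power power_less_one_iff)
  have "(\<lambda>n. \<Prod>j<n. 1 - q * q ^ j) \<longlonglongrightarrow> qpoch_inf q q" by (rule qpoch_inf_LIMSEQ[OF q])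
  hence "(\<lambda>n. \<Prod>j<n * m. 1 - q * q ^ j) \<longlonglongrightarrow> qpoch_inf q q"
    using LIMSEQ_subseq_LIMSEQ[of _ _ "\<lambda>n. n * m"] m by (fastforce simp: o_def strict_mono_def)
  also have "(\<lambda>n. \<Prod>j<n * m. 1 - q * q ^ j) = (\<lambda>n. \<Prod>i=1..m. \<Prod>j<n. 1 - q ^ i * (q ^ m) ^ j)"
  proof
    fix n
    have "(\<Prod>j<n * m. 1 - q * q ^ j) = (\<Prod>k<n. \<Prod>j\<in>{k * m..<k * m + m}. 1 - q * q ^ j)"
      by (rule prod.nat_group[symmetric])
    also have "\<dots> = (\<Prod>k<n. \<Prod>i=1..m. 1 - q ^ i * (q ^ m) ^ k)"
    proof (rule prod.cong[OF refl])
      fix k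
      show "(\<Prod>j\<in>{k * m..<k * m + m}. 1 - q * q ^ j) = (\<Prod>i=1..m. 1 - q ^ i * (q ^ m) ^ k)"
      proof (rule prod.reindex_bij_witness[of _ "\<lambda>i. k * m + i - 1" "\<lambda>j. j - k * m + 1"])
        fix j assume j: "j \<in> {k * m..<k * m + m}"
        then obtain l where "j = k * m + l" by (auto simp: le_iff_add)
        thus "1 - q ^ (j - k * m + 1) * (q ^ m) ^ k = 1 - q * q ^ j"
          by (simp add: power_add power_mult mult.commute[of k])
      qed auto
    qed
    also have "\<dots> = (\<Prod>i=1..m. \<Prod>j<n. 1 - q ^ i * (q ^ m) ^ j)" by (rule prod.swap)
    finally show "(\<Prod>j<n * m. 1 - q * q ^ j) = (\<Prod>i=1..m. \<Prod>j<n. 1 - q ^ i * (q ^ m) ^ j)" .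
  qed
  finally have "(\<lambda>n. \<Prod>i=1..m. \<Prod>j<n. 1 - q ^ i * (q ^ m) ^ j) \<longlonglongrightarrow> qpoch_inf q q" .
  moreover have "(\<lambda>n. \<Prod>i=1..m. \<Prod>j<n. 1 - q ^ i * (q ^ m) ^ j) \<longlonglongrightarrow> (\<Prod>i=1..m. qpoch_inf (q ^ i) (q ^ m))"
    by (intro tendsto_prod qpoch_inf_LIMSEQ[OF qm])
  ultimately show ?thesis by (rule LIMSEQ_unique)
qed

lemma theta_f1_minus:
  assumes "norm q < 1"
  shows "theta_f1 (- q) = qpoch_inf q q"
proof -
  have "norm q ^ 3 < 1" using assms by (simp add: power_less_one_iff)
  hence lt: "norm ((- q) * (- (q\<^sup>2))) < 1" by (simp add: norm_mult norm_power eval_nat_numeral)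
  have "(- q) * (- (q\<^sup>2)) = q ^ 3" by (simp add: eval_nat_numeral)
  thus ?thesis
    using jacobi_triple_product[OF lt] qpoch_inf_dissection[OF assms, of 3]
    by (simp add: theta_f1_def eval_nat_numeral atLeastAtMostSuc_conv)
qed

section \<open>The six identities and their product\<close>

text \<open>
  The exponents \<open>7 - i\<close> and \<open>6 + i\<close> run through \<open>1, \<dots>, 12\<close>. The dissection of \<open>(q; q)\<close> modulo
  \<open>13\<close> absorbs these factors and one of the six factors \<open>(q\<^sup>1\<^sup>3; q\<^sup>1\<^sup>3)\<close>.
\<close>

lemma prod_theta_f_eq:
  assumes q: "norm q < 1"
  shows "(\<Prod>i=1..6. theta_f (- (q ^ (7 - i))) (- (q ^ (6 + i)))) =
           qpoch_inf q q * qpoch_inf (q ^ 13) (q ^ 13) ^ 5"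
proof -
  let ?L = "qpoch_inf (q ^ 13) (q ^ 13)"
  have q13: "norm (q ^ 13) < 1" using q by (simp add: norm_power power_less_one_iff)
  have "theta_f (- (q ^ (7 - i))) (- (q ^ (6 + i))) =
      qpoch_inf (q ^ (7 - i)) (q ^ 13) * qpoch_inf (q ^ (6 + i)) (q ^ 13) * ?L" if "i \<in> {1..6}" for i
  proof -
    have "(7 - i) + (6 + i) = 13" using that by auto
    hence eq: "(- (q ^ (7 - i))) * (- (q ^ (6 + i))) = q ^ 13"
      by (simp only: minus_mult_minus power_add[symmetric])
    show ?thesis using jacobi_triple_product[of "- (q ^ (7 - i))" "- (q ^ (6 + i))"] q13
      unfolding eq by simp
  qed
  hence "(\<Prod>i=1..6. theta_f (- (q ^ (7 - i))) (- (q ^ (6 + i)))) =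
      (\<Prod>i=1..6. qpoch_inf (q ^ (7 - i)) (q ^ 13) * qpoch_inf (q ^ (6 + i)) (q ^ 13) * ?L)"
    by (intro prod.cong refl) auto
  also have "\<dots> = (\<Prod>i=1..13. qpoch_inf (q ^ i) (q ^ 13)) * ?L ^ 5"
    by (simp add: eval_nat_numeral atLeastAtMostSuc_conv mult_ac)
  also have "(\<Prod>i=1..13. qpoch_inf (q ^ i) (q ^ 13)) = qpoch_inf q q"
    using qpoch_inf_dissection[OF q, of 13] by simp
  finally show ?thesis .
qed

theorem theorem3p2:
  fixes q s :: complex
  assumes "norm q < 1" and "s ^ 2 = q"
  shows "(\<forall>e\<in>{1, -1 :: complex}.
          1 / theta_B 1 q - e * s * theta_B 1 q =
            theta_f (- e * s) (- e * s ^ 25) * theta_phi (e * s ^ 13) /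
              (theta_f (- (q ^ 6)) (- (q ^ 7)) * theta_psi (q ^ 13)) \<and>
          1 / theta_B 2 q - e * s ^ 3 * theta_B 2 q =
            theta_f (- e * s ^ 3) (- e * s ^ 23) * theta_phi (e * s ^ 13) /
              (theta_f (- (q ^ 5)) (- (q ^ 8)) * theta_psi (q ^ 13)) \<and>
          1 / theta_B 3 q - e * s ^ 5 * theta_B 3 q =
            theta_f (- e * s ^ 5) (- e * s ^ 21) * theta_phi (e * s ^ 13) /
              (theta_f (- (q ^ 4)) (- (q ^ 9)) * theta_psi (q ^ 13)) \<and>
          1 / theta_B 4 q - e * s ^ 7 * theta_B 4 q =
            theta_f (- e * s ^ 7) (- e * s ^ 19) * theta_phi (e * s ^ 13) /
              (theta_f (- (q ^ 3)) (- (q ^ 10)) * theta_psi (q ^ 13)) \<and>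
          1 / theta_B 5 q - e * s ^ 9 * theta_B 5 q =
            theta_f (- e * s ^ 9) (- e * s ^ 17) * theta_phi (e * s ^ 13) /
              (theta_f (- (q ^ 2)) (- (q ^ 11)) * theta_psi (q ^ 13)) \<and>
          1 / theta_B 6 q - e * s ^ 11 * theta_B 6 q =
            theta_f (- e * s ^ 11) (- e * s ^ 15) * theta_phi (e * s ^ 13) /
              (theta_f (- q) (- (q ^ 12)) * theta_psi (q ^ 13))) \<and>
         (\<Prod>i=1..6. 1 / theta_B i q + s ^ (2 * (i - 1) + 1) * theta_B i q) =
            theta_phi (- (s ^ 13)) ^ 6 * theta_f1 (- (q ^ 13)) /
              (theta_psi (q ^ 13) ^ 6 * theta_f1 (- q)) *
            (\<Prod>i=1..6. qpoch_inf (- (s ^ (2 * (i - 1) + 1))) (q ^ 13) *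
                       qpoch_inf (- (s ^ (26 - (2 * (i - 1) + 1)))) (q ^ 13))"
proof -
  have s: "norm s < 1"
    using assms by (auto simp: norm_power power_less_one_iff)
  have q13: "norm (q ^ 13) < 1"
    using assms(1) by (simp add: norm_power power_less_one_iff)
  note id = theta_B_identity[OF s, unfolded assms(2)]
  let ?L = "qpoch_inf (q ^ 13) (q ^ 13)"
  let ?R = "\<Prod>i=1..6. qpoch_inf (- (s ^ (2 * (i - 1) + 1))) (q ^ 13) *
                       qpoch_inf (- (s ^ (26 - (2 * (i - 1) + 1)))) (q ^ 13)"
  have cancel: "r * (l * p / y) ^ 6 / (c * l ^ 5) = p ^ 6 * l / (y ^ 6 * c) * r"
    if "l \<noteq> 0" for r l p y c :: complex
  proof -
    have "r * (l * p / y) ^ 6 / (c * l ^ 5) = r * p ^ 6 / (y ^ 6 * c) * (l ^ 6 / l ^ 5)"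
      by (simp add: power_divide power_mult_distrib mult_ac)
    also have "l ^ 6 / l ^ 5 = l" using that power_diff[of l 5 6] by simp
    finally show ?thesis by simp
  qed
  have factor: "1 / theta_B i q + s ^ (2 * (i - 1) + 1) * theta_B i q =
      qpoch_inf (- (s ^ (2 * (i - 1) + 1))) (q ^ 13) *
        qpoch_inf (- (s ^ (26 - (2 * (i - 1) + 1)))) (q ^ 13) *
      (?L * theta_phi (- (s ^ 13)) / theta_psi (q ^ 13)) /
      theta_f (- (q ^ (7 - i))) (- (q ^ (6 + i)))" if i: "i \<in> {1..6}" for i
  proof -
    have idx: "2 * i - 1 = 2 * (i - 1) + 1" "27 - 2 * i = 26 - (2 * (i - 1) + 1)"
      using i by auto
    have "s ^ (2 * (i - 1) + 1) * s ^ (26 - (2 * (i - 1) + 1)) = s ^ 26"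
      unfolding power_add[symmetric] using i by (intro arg_cong[of _ _ "power s"]) auto
    also have "\<dots> = q ^ 13" unfolding assms(2)[symmetric] by (simp add: power_mult[symmetric])
    finally have eq: "s ^ (2 * (i - 1) + 1) * s ^ (26 - (2 * (i - 1) + 1)) = q ^ 13" .
    have "1 / theta_B i q + s ^ (2 * (i - 1) + 1) * theta_B i q =
      theta_f (s ^ (2 * (i - 1) + 1)) (s ^ (26 - (2 * (i - 1) + 1))) * theta_phi (- (s ^ 13)) /
      (theta_f (- (q ^ (7 - i))) (- (q ^ (6 + i))) * theta_psi (q ^ 13))"
      using id[of "- 1" i] i unfolding idx by simp
    also have "theta_f (s ^ (2 * (i - 1) + 1)) (s ^ (26 - (2 * (i - 1) + 1))) =
        qpoch_inf (- (s ^ (2 * (i - 1) + 1))) (q ^ 13) *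
        qpoch_inf (- (s ^ (26 - (2 * (i - 1) + 1)))) (q ^ 13) * ?L"
      using jacobi_triple_product[of "s ^ (2 * (i - 1) + 1)" "s ^ (26 - (2 * (i - 1) + 1))"] q13
      unfolding eq by blast
    finally show ?thesis by (simp only: times_divide_eq_left times_divide_eq_right divide_divide_eq_left mult_ac)
  qed
  have "(\<Prod>i=1..6. 1 / theta_B i q + s ^ (2 * (i - 1) + 1) * theta_B i q) =
      (\<Prod>i=1..6. qpoch_inf (- (s ^ (2 * (i - 1) + 1))) (q ^ 13) *
        qpoch_inf (- (s ^ (26 - (2 * (i - 1) + 1)))) (q ^ 13) *
      (?L * theta_phi (- (s ^ 13)) / theta_psi (q ^ 13)) /
      theta_f (- (q ^ (7 - i))) (- (q ^ (6 + i))))"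
    by (rule prod.cong[OF refl factor])
  also have "\<dots> = ?R * (?L * theta_phi (- (s ^ 13)) / theta_psi (q ^ 13)) ^ 6 /
      (qpoch_inf q q * ?L ^ 5)"
    unfolding prod_dividef prod.distrib prod_theta_f_eq[OF assms(1)]
    by (simp add: power_divide power_mult_distrib)
  also have "\<dots> = theta_phi (- (s ^ 13)) ^ 6 * ?L / (theta_psi (q ^ 13) ^ 6 * qpoch_inf q q) * ?R"
    by (rule cancel[OF qpoch_inf_self_nonzero[OF q13]])
  finally have "(\<Prod>i=1..6. 1 / theta_B i q + s ^ (2 * (i - 1) + 1) * theta_B i q) =
      theta_phi (- (s ^ 13)) ^ 6 * theta_f1 (- (q ^ 13)) /
        (theta_psi (q ^ 13) ^ 6 * theta_f1 (- q)) * ?R"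
    by (simp only: theta_f1_minus[OF q13] theta_f1_minus[OF assms(1)])
  moreover have "1 / theta_B i q - e * s ^ (2 * i - 1) * theta_B i q =
    theta_f (- e * s ^ (2 * i - 1)) (- e * s ^ (27 - 2 * i)) * theta_phi (e * s ^ 13) /
      (theta_f (- (q ^ (7 - i))) (- (q ^ (6 + i))) * theta_psi (q ^ 13))"
    if "e \<in> {1, - 1}" "i \<in> {1..6}" for e i
    using id[OF that] .
  from this[of _ 1] this[of _ 2] this[of _ 3] this[of _ 4] this[of _ 5] this[of _ 6]
  have "\<forall>e\<in>{1, -1 :: complex}.
          1 / theta_B 1 q - e * s * theta_B 1 q =
            theta_f (- e * s) (- e * s ^ 25) * theta_phi (e * s ^ 13) /
              (theta_f (- (q ^ 6)) (- (q ^ 7)) * theta_psi (q ^ 13)) \<and>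
          1 / theta_B 2 q - e * s ^ 3 * theta_B 2 q =
            theta_f (- e * s ^ 3) (- e * s ^ 23) * theta_phi (e * s ^ 13) /
              (theta_f (- (q ^ 5)) (- (q ^ 8)) * theta_psi (q ^ 13)) \<and>
          1 / theta_B 3 q - e * s ^ 5 * theta_B 3 q =
            theta_f (- e * s ^ 5) (- e * s ^ 21) * theta_phi (e * s ^ 13) /
              (theta_f (- (q ^ 4)) (- (q ^ 9)) * theta_psi (q ^ 13)) \<and>
          1 / theta_B 4 q - e * s ^ 7 * theta_B 4 q =
            theta_f (- e * s ^ 7) (- e * s ^ 19) * theta_phi (e * s ^ 13) /
              (theta_f (- (q ^ 3)) (- (q ^ 10)) * theta_psi (q ^ 13)) \<and>
          1 / theta_B 5 q - e * s ^ 9 * theta_B 5 q =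
            theta_f (- e * s ^ 9) (- e * s ^ 17) * theta_phi (e * s ^ 13) /
              (theta_f (- (q ^ 2)) (- (q ^ 11)) * theta_psi (q ^ 13)) \<and>
          1 / theta_B 6 q - e * s ^ 11 * theta_B 6 q =
            theta_f (- e * s ^ 11) (- e * s ^ 15) * theta_phi (e * s ^ 13) /
              (theta_f (- q) (- (q ^ 12)) * theta_psi (q ^ 13))" by simp
  ultimately show ?thesis by blast
qed

end
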